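(* Let $f:\mathbb{R}\to\mathbb{R}$ be convex and $L$-smooth with $L>0$, let $S=\operatorname{Argmin} f\neq\varnothing$ and $f^*=\min f(\mathbb{R})$. Let $x_0\in\mathbb{R}$ and let $x^*=P_S(x_0)$ be the point of $S$ closest to $x_0$. Let $(x_k)_{k\in\mathbb{N}},(y_k)_{k\in\mathbb{N}},(t_k)_{k\in\mathbb{N}}$ be generated by Algorithm 1 (described in the context) from $x_0$ and an input parameter sequence $(\widetilde t_k)_{k\in\mathbb{N}}$. Suppose that iteration $r$ is the first iteration where $f'(y_r)(x_{r+1}-x_r)>0$, and that iteration $\overline r$ is the second iteration where $f'(y_{\overline r})(x_{\overline r+1}-x_{\overline r})>0$. Then the following hold. (i) For all $k\le r+1$: $f(x_k)-f^*\le \dfrac{2L(x_0-x^* )^2}{(k+1)^2}$. (ii) $f(x_{r+2})\le f(x_{r+1})$. (iii) For all $k\in\{r+3,\ldots,\overline r+1\}$: $$f(x_k)-f^*\le\left(\frac{4}{(k-r)(r+2)}\right)^2\frac{L(x_0-x^* )^2}{2}\le\frac{2L(x_0-x^* )^2}{(k+1)^2}.$$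
   Context: $\mathbb{N}=\{0,1,2,\dots\}$. $L$-smooth means $f$ is differentiable and $|f'(x)-f'(y)|\le L|x-y|$ for all $x,y\in\mathbb{R}$. Set $T(y)=y-\tfrac1L f'(y)$. Algorithm 1 (accelerated gradient descent with restarts). Input: $x_0\in\mathbb{R}$ and a real sequence $(\widetilde t_k)_{k\in\mathbb{N}}$ with $\widetilde t_0=1$, $\widetilde t_k\ge\frac{k+2}{2}$ for all $k\ge 1$, and $\widetilde t_k^{\,2}\ge \widetilde t_{k+1}^{\,2}-\widetilde t_{k+1}$ for all $k\ge 0$. Initialization: $y_0=x_0$ and $t_k:=\widetilde t_k$ for all $k\in\mathbb{N}$. For $k=0,1,2,\dots$: set $x_{k+1}:=T(y_k)$. If $f'(y_k)(x_{k+1}-x_k)\le 0$, set $y_{k+1}:=x_{k+1}+\frac{t_k-1}{t_{k+1}}(x_{k+1}-x_k)$. Otherwise (the restart condition $f'(y_k)(x_{k+1}-x_k)>0$ holds at iteration $k$) restart: set $y_{k+1}:=x_{k+1}$ and redefine $t_{k+1+m}:=\widetilde t_m$ for all $m\in\mathbb{N}$. Stopping convention: if $f'(x_k)=0$ for some $k$, then $x_k$ is a minimizer and the algorithm is stopped. Thus, since iterations $r$ and $\overline r$ are carried out, $f'(x_j)\ne 0$ for all $0\le j\le\overline r$. *)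

theory Defs
  imports "HOL-Analysis.Analysis"
begin

definition L_smooth :: "real \<Rightarrow> (real \<Rightarrow> real) \<Rightarrow> bool" where
  "L_smooth L f \<longleftrightarrow>
     (\<forall>x. f differentiable at x) \<and>
     (\<forall>x y. \<bar>deriv f x - deriv f y\<bar> \<le> L * \<bar>x - y\<bar>)"

definition Argmin :: "(real \<Rightarrow> real) \<Rightarrow> real set" where
  "Argmin f = {x. is_arg_min f (\<lambda>_. True) x}"

definition gradient_step :: "(real \<Rightarrow> real) \<Rightarrow> real \<Rightarrow> real \<Rightarrow> real" where
  "gradient_step f L y = y - (1 / L) * deriv f y"

definition admissible_params :: "(nat \<Rightarrow> real) \<Rightarrow> bool" where
  "admissible_params tt \<longleftrightarrow>
     tt 0 = 1 \<and>
     (\<forall>k\<ge>1. tt k \<ge> (real k + 2) / 2) \<and>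
     (\<forall>k. (tt k)\<^sup>2 \<ge> (tt (k + 1))\<^sup>2 - tt (k + 1))"

text \<open>
  The state before iteration \<open>k\<close> consists of \<open>x\<^sub>k\<close>, \<open>y\<^sub>k\<close> and the current version of the
  whole parameter sequence \<open>t\<close>. A restart at iteration \<open>k\<close> overwrites the entries of \<open>t\<close> from
  index \<open>k + 1\<close> on by those of the input sequence \<open>tt\<close>.

  The recursion is total: it continues formally even after an iterate with zero derivative, at
  which the algorithm stops. That an iteration is really carried out has to be required
  separately.
\<close>

primrec agd_state ::
  "(real \<Rightarrow> real) \<Rightarrow> real \<Rightarrow> real \<Rightarrow> (nat \<Rightarrow> real) \<Rightarrow> nat \<Rightarrow> real \<times> real \<times> (nat \<Rightarrow> real)"
where
  "agd_state f L x0 tt 0 = (x0, x0, tt)"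
| "agd_state f L x0 tt (Suc k) =
     (case agd_state f L x0 tt k of (x, y, t) \<Rightarrow>
        let x' = gradient_step f L y in
        if deriv f y * (x' - x) \<le> 0
        then (x', x' + (t k - 1) / t (k + 1) * (x' - x), t)
        else (x', x', \<lambda>j. if j \<le> k then t j else tt (j - (k + 1))))"

definition agd_x :: "(real \<Rightarrow> real) \<Rightarrow> real \<Rightarrow> real \<Rightarrow> (nat \<Rightarrow> real) \<Rightarrow> nat \<Rightarrow> real" where
  "agd_x f L x0 tt k = fst (agd_state f L x0 tt k)"

definition agd_y :: "(real \<Rightarrow> real) \<Rightarrow> real \<Rightarrow> real \<Rightarrow> (nat \<Rightarrow> real) \<Rightarrow> nat \<Rightarrow> real" where
  "agd_y f L x0 tt k = fst (snd (agd_state f L x0 tt k))"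

definition restart_at :: "(real \<Rightarrow> real) \<Rightarrow> (nat \<Rightarrow> real) \<Rightarrow> (nat \<Rightarrow> real) \<Rightarrow> nat \<Rightarrow> bool" where
  "restart_at f x y k \<longleftrightarrow> deriv f (y k) * (x (k + 1) - x k) > 0"

end

theory Submission
  imports Defs
begin

text \<open>
  Between two restarts the algorithm is accelerated gradient descent, for which
  \<open>(2/L) t\<^sub>k\<^sup>2 (f x\<^sub>k\<^sub>+\<^sub>1 - f z) + u\<^sub>k\<^sup>2\<close> with
  \<open>u\<^sub>k = t\<^sub>k (x\<^sub>k\<^sub>+\<^sub>1 - z) - (t\<^sub>k - 1) (x\<^sub>k - z)\<close> is nonincreasing for every minimizer \<open>z\<close>.
  On the real line a gradient step never crosses a minimizer, so the first restart can only be
  caused by an extrapolation that overshoots \<open>x\<^sup>*\<close>. Then \<open>x\<^sub>r\<close> and \<open>x\<^sub>r\<^sub>+\<^sub>1\<close> lie on opposite sides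
  of \<open>x\<^sup>*\<close>, the two terms of \<open>u\<^sub>r\<close> have the same sign, and \<open>t\<^sub>r \<bar>x\<^sub>r\<^sub>+\<^sub>1 - x\<^sup>*\<bar> \<le> \<bar>u\<^sub>r\<bar> \<le> \<bar>x\<^sub>0 - x\<^sup>*\<bar>\<close>.
  Hence the second run starts from a point that is closer by a factor \<open>t\<^sub>r\<close>.
\<close>

section \<open>Convexity and smoothness inequalities\<close>

lemma L_smooth_DERIV:
  assumes "L_smooth L f"
  shows "(f has_real_derivative deriv f x) (at x)"
  using assms unfolding L_smooth_def
  by (simp add: DERIV_deriv_iff_real_differentiable)

lemma convex_above_tangent:
  assumes "convex_on UNIV f" "L_smooth L f"
  shows "f y + deriv f y * (w - y) \<le> f w"
  using convex_on_imp_above_tangent[OF assms(1), of y w "deriv f y"] L_smooth_DERIV[OF assms(2), of y]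
  by simp

lemma L_smooth_descent:
  assumes "L_smooth L f"
  shows "f (y + h) \<le> f y + deriv f y * h + L / 2 * h\<^sup>2"
proof -
  \<comment> \<open>Up to a constant, \<open>g\<close> compares \<open>f\<close> on the segment from
    \<open>y\<close> to \<open>y + h\<close> with its quadratic upper model. The Lipschitz bound
    makes its derivative nonpositive on [0,1].\<close>
  define g where "g s = f (y + s * h) - s * (deriv f y * h) - L / 2 * h\<^sup>2 * s\<^sup>2" for s
  have "g 1 \<le> g 0"
  proof (rule DERIV_nonpos_imp_nonincreasing[of 0 1 g])
    fix s :: real
    assume s: "0 \<le> s" "s \<le> 1"
    have der: "(g has_real_derivative (deriv f (y + s * h) * h - deriv f y * h - L * h\<^sup>2 * s)) (at s)"
      unfolding g_def
      by (rule derivative_eq_intros DERIV_chain2[OF L_smooth_DERIV[OF assms]] refl | simp)+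
    have "(deriv f (y + s * h) - deriv f y) * h \<le> \<bar>deriv f (y + s * h) - deriv f y\<bar> * \<bar>h\<bar>"
      by (metis abs_ge_self abs_mult)
    also have "\<dots> \<le> (L * \<bar>s * h\<bar>) * \<bar>h\<bar>"
      using assms unfolding L_smooth_def
      by (intro mult_right_mono) (metis add_diff_cancel_left', simp)
    also have "\<dots> = L * h\<^sup>2 * s"
      using s by (simp add: abs_mult power2_eq_square mult_ac)
    finally show "\<exists>l. (g has_real_derivative l) (at s) \<and> l \<le> 0"
      using der by (intro exI conjI) (auto simp: algebra_simps)
  qed simp
  then show ?thesis by (simp add: g_def)
qed

text \<open>The descent inequality for the step -f'(y)/L, combined with the tangent at
  \<open>y\<close> evaluated at \<open>w\<close>. The point \<open>w\<close> stays free because the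
  previous iterate and the minimizer are both inserted later.\<close>

lemma gradient_step_le:
  assumes "convex_on UNIV f" "L_smooth L f" "L > 0"
  shows "f (gradient_step f L y) \<le> f w + deriv f y * (y - w) - (deriv f y)\<^sup>2 / (2 * L)"
proof -
  have "f (gradient_step f L y) \<le> f y - (deriv f y)\<^sup>2 / (2 * L)"
    using L_smooth_descent[OF assms(2), of y "- (1 / L) * deriv f y"] assms(3)
    by (simp add: gradient_step_def field_simps power2_eq_square)
  with convex_above_tangent[OF assms(1,2), of y w] show ?thesis
    by (simp add: algebra_simps)
qed

lemma deriv_minimizer_eq_0:
  assumes "L_smooth L f" "\<And>w. f z \<le> f w"
  shows "deriv f z = 0"
  using DERIV_local_min[OF L_smooth_DERIV[OF assms(1), of z], of 1] assms(2) by simp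

lemma admissible_params_ge:
  assumes "admissible_params tt"
  shows "(real k + 2) / 2 \<le> tt k"
  using assms unfolding admissible_params_def by (cases k) auto

lemma admissible_params_ge_1:
  assumes "admissible_params tt"
  shows "1 \<le> tt k"
  using admissible_params_ge[OF assms, of k] by simp

section \<open>The potential of a run without restarts\<close>

text \<open>Abstract sequences let the same estimate serve the run from 0 and, after an index shift,
  the run from \<open>Suc r\<close>. Extrapolation is required only below \<open>N\<close>, since
  iteration \<open>N\<close> may itself trigger a restart, which affects \<open>Y (Suc N)\<close>
  but not \<open>X (Suc N)\<close>.\<close>

lemma accelerated_lyapunov:
  assumes f: "convex_on UNIV f" "L_smooth L f" "L > 0" and tt: "admissible_params tt"
    and z: "\<And>w. f z \<le> f w"
    and Y0: "Y 0 = X 0"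
    and X: "\<And>n. n \<le> N \<Longrightarrow> X (Suc n) = gradient_step f L (Y n)"
    and Y: "\<And>n. n < N \<Longrightarrow> Y (Suc n) = X (Suc n) + (tt n - 1) / tt (Suc n) * (X (Suc n) - X n)"
    and "n \<le> N"
  shows "2 / L * (tt n)\<^sup>2 * (f (X (Suc n)) - f z)
    + (tt n * (X (Suc n) - z) - (tt n - 1) * (X n - z))\<^sup>2 \<le> (X 0 - z)\<^sup>2"
  using \<open>n \<le> N\<close>
proof (induction n)
  case 0
  define p where "p = deriv f (Y 0)"
  have "f (X 1) \<le> f z + p * (X 0 - z) - p\<^sup>2 / (2 * L)"
    using gradient_step_le[OF f, of "Y 0" z] X[of 0] Y0 by (simp add: p_def)
  then have "2 / L * (f (X 1) - f z) \<le> 2 / L * (p * (X 0 - z) - p\<^sup>2 / (2 * L))"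
    using f(3) by (intro mult_left_mono) auto
  moreover have X1: "X 1 = X 0 - p / L"
    using X[of 0] Y0 by (simp add: p_def gradient_step_def)
  have "(X 1 - z)\<^sup>2 = (X 0 - z)\<^sup>2 - 2 / L * (p * (X 0 - z) - p\<^sup>2 / (2 * L))"
    unfolding X1 using f(3) by (simp add: field_simps power2_eq_square)
  moreover have "tt 0 = 1" using tt by (simp add: admissible_params_def)
  ultimately show ?case by simp
next
  case (Suc n)
  define p t a where "p = deriv f (Y (Suc n))" and "t = tt (Suc n)"
    and "a = tt n * (X (Suc n) - z) - (tt n - 1) * (X n - z)"
  have t1: "1 \<le> t" using admissible_params_ge_1[OF tt] by (simp add: t_def)
  have tY: "t * Y (Suc n) = t * X (Suc n) + (tt n - 1) * (X (Suc n) - X n)"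
    using Y[of n] Suc.prems t1 by (simp add: t_def distrib_left)
  \<comment> \<open>The extrapolation coefficient is chosen for this identity: the \<open>a\<close>
    from the previous step is also what multiplies \<open>p\<close> in the weighted sum
    below.\<close>
  have a: "t * Y (Suc n) - (t - 1) * X (Suc n) - z = a"
    unfolding tY a_def by (simp add: algebra_simps)
  have Xp: "X (Suc (Suc n)) = Y (Suc n) - p / L"
    using X[of "Suc n"] Suc.prems by (simp add: p_def gradient_step_def)
  have b: "f (X (Suc (Suc n))) \<le> f w + p * (Y (Suc n) - w) - p\<^sup>2 / (2 * L)" for w
    using gradient_step_le[OF f, of "Y (Suc n)" w] X[of "Suc n"] Suc.prems by (simp add: p_def)
  \<comment> \<open>The one-step bound is used at \<open>w = X (Suc n)\<close> with weight
    \<open>t - 1\<close> and at \<open>w = z\<close> with weight 1.\<close>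
  have "(t - 1) * f (X (Suc (Suc n))) + f (X (Suc (Suc n)))
      \<le> (t - 1) * (f (X (Suc n)) + p * (Y (Suc n) - X (Suc n)) - p\<^sup>2 / (2 * L))
        + (f z + p * (Y (Suc n) - z) - p\<^sup>2 / (2 * L))"
    using b t1 by (intro add_mono mult_left_mono) auto
  also have "\<dots> = (t - 1) * f (X (Suc n)) + f z
      + p * (t * Y (Suc n) - (t - 1) * X (Suc n) - z) - t * (p\<^sup>2 / (2 * L))"
    by (simp add: algebra_simps diff_divide_distrib)
  finally have "t * (f (X (Suc (Suc n))) - f z)
      \<le> (t - 1) * (f (X (Suc n)) - f z) + p * a - t * (p\<^sup>2 / (2 * L))"
    unfolding a by (simp add: algebra_simps)
  \<comment> \<open>The factor \<open>2 / L * t\<close> completes the square: the terms in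
    \<open>p\<close> become the difference of the squares of \<open>a\<close> and
    \<open>a - t * p / L\<close>, the latter being the next u.\<close>
  then have "2 / L * t * (t * (f (X (Suc (Suc n))) - f z))
      \<le> 2 / L * t * ((t - 1) * (f (X (Suc n)) - f z) + p * a - t * (p\<^sup>2 / (2 * L)))"
    using t1 f(3) by (intro mult_left_mono) auto
  moreover have "2 / L * t * ((t - 1) * (f (X (Suc n)) - f z) + p * a - t * (p\<^sup>2 / (2 * L)))
      = 2 / L * (t\<^sup>2 - t) * (f (X (Suc n)) - f z) + a\<^sup>2 - (a - t * p / L)\<^sup>2"
    using f(3) by (simp add: field_simps power2_eq_square)
  moreover have "2 / L * t * (t * (f (X (Suc (Suc n))) - f z)) = 2 / L * t\<^sup>2 * (f (X (Suc (Suc n))) - f z)"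
    by (simp add: power2_eq_square)
  moreover have u: "t * (X (Suc (Suc n)) - z) - (t - 1) * (X (Suc n) - z) = a - t * p / L"
    unfolding Xp a[symmetric] by (simp add: algebra_simps)
  moreover have "2 / L * (t\<^sup>2 - t) * (f (X (Suc n)) - f z) \<le> 2 / L * (tt n)\<^sup>2 * (f (X (Suc n)) - f z)"
    using tt z f(3) unfolding t_def admissible_params_def
    by (intro mult_right_mono mult_left_mono) auto
  moreover have "2 / L * (tt n)\<^sup>2 * (f (X (Suc n)) - f z) + a\<^sup>2 \<le> (X 0 - z)\<^sup>2"
    using Suc.IH Suc.prems by (simp only: a_def Suc_leD)
  ultimately show ?case
    unfolding t_def[symmetric] u by linarith
qed

text \<open>The square in the potential is dropped and \<open>tt n\<close> is replaced by its lower
  bound \<open>(real n + 2) / 2\<close>.\<close>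

lemma accelerated_rate:
  assumes f: "convex_on UNIV f" "L_smooth L f" "L > 0" and tt: "admissible_params tt"
    and z: "\<And>w. f z \<le> f w"
    and Y0: "Y 0 = X 0"
    and X: "\<And>n. n \<le> N \<Longrightarrow> X (Suc n) = gradient_step f L (Y n)"
    and Y: "\<And>n. n < N \<Longrightarrow> Y (Suc n) = X (Suc n) + (tt n - 1) / tt (Suc n) * (X (Suc n) - X n)"
    and "n \<le> N"
  shows "f (X (Suc n)) - f z \<le> 2 * L * (X 0 - z)\<^sup>2 / (real n + 2)\<^sup>2"
proof -
  have "2 / L * (tt n)\<^sup>2 * (f (X (Suc n)) - f z) \<le> (X 0 - z)\<^sup>2"
    using accelerated_lyapunov[OF assms]
      zero_le_power2[of "tt n * (X (Suc n) - z) - (tt n - 1) * (X n - z)"] by linarith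
  moreover have "2 / L * ((real n + 2) / 2)\<^sup>2 * (f (X (Suc n)) - f z)
      \<le> 2 / L * (tt n)\<^sup>2 * (f (X (Suc n)) - f z)"
    using admissible_params_ge[OF tt, of n] z f(3)
    by (intro mult_right_mono mult_left_mono power_mono) auto
  ultimately have "2 / L * ((real n + 2) / 2)\<^sup>2 * (f (X (Suc n)) - f z) \<le> (X 0 - z)\<^sup>2"
    by linarith
  then show ?thesis using f(3) by (simp add: field_simps)
qed

section \<open>Unfolding the algorithm along a run\<close>

lemma agd_x_Suc: "agd_x f L x0 tt (Suc k) = gradient_step f L (agd_y f L x0 tt k)"
  by (auto simp: agd_x_def agd_y_def Let_def split: prod.splits)

lemma agd_y_restart:
  assumes "restart_at f (agd_x f L x0 tt) (agd_y f L x0 tt) k"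
  shows "agd_y f L x0 tt (Suc k) = agd_x f L x0 tt (Suc k)"
  using assms agd_x_Suc[of f L x0 tt k]
  by (auto simp: agd_x_def agd_y_def restart_at_def Let_def split: prod.splits)

text \<open>Here \<open>s\<close> is the start of a run, either 0 or the index after a restart. Only
  a restart rewrites the parameters, so the shifted copy of \<open>tt\<close> survives until the
  next one.\<close>

lemma agd_t_run:
  assumes "\<forall>j\<ge>s. snd (snd (agd_state f L x0 tt s)) j = tt (j - s)"
    and "\<And>i. i < n \<Longrightarrow> \<not> restart_at f (agd_x f L x0 tt) (agd_y f L x0 tt) (s + i)"
  shows "\<forall>j\<ge>s. snd (snd (agd_state f L x0 tt (s + n))) j = tt (j - s)"
  using assms(2)
proof (induction n)
  case 0
  then show ?case using assms(1) by simp
next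
  case (Suc n)
  from Suc.prems[of n] Suc show ?case
    using agd_x_Suc[of f L x0 tt "s + n"]
    by (auto simp: agd_x_def agd_y_def restart_at_def Let_def split: prod.splits)
qed

lemma agd_y_run:
  assumes "\<forall>j\<ge>s. snd (snd (agd_state f L x0 tt s)) j = tt (j - s)"
    and "\<And>i. i \<le> n \<Longrightarrow> \<not> restart_at f (agd_x f L x0 tt) (agd_y f L x0 tt) (s + i)"
  shows "agd_y f L x0 tt (s + Suc n) = agd_x f L x0 tt (s + Suc n)
    + (tt n - 1) / tt (Suc n) * (agd_x f L x0 tt (s + Suc n) - agd_x f L x0 tt (s + n))"
  using agd_t_run[OF assms(1), of n] assms(2)[of n] assms(2) agd_x_Suc[of f L x0 tt "s + n"]
  by (auto simp: agd_x_def agd_y_def restart_at_def Let_def Suc_diff_le split: prod.splits)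

lemma agd_t_restart:
  assumes "restart_at f (agd_x f L x0 tt) (agd_y f L x0 tt) k"
  shows "\<forall>j\<ge>Suc k. snd (snd (agd_state f L x0 tt (Suc k))) j = tt (j - Suc k)"
  using assms agd_x_Suc[of f L x0 tt k]
  by (auto simp: agd_x_def agd_y_def restart_at_def Let_def split: prod.splits)

section \<open>Geometry of the first restart\<close>

text \<open>Normalized coordinates: the minimizer is 0, the start is nonnegative, and
  \<open>g\<close> stands for f'. The bounds on \<open>g\<close> say that a gradient step moves
  towards 0 without crossing it. Before the restart the \<open>X n\<close> decrease, so momentum
  points left and \<open>Y n \<le> X n\<close>. If \<open>Y r\<close> were nonnegative, the last
  step would go left with \<open>g (Y r) \<ge> 0\<close>, contradicting the restart
  condition.\<close>

lemma overshoot_nonneg: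
  fixes X Y :: "nat \<Rightarrow> real" and g :: "real \<Rightarrow> real"
  assumes L: "L > 0"
    and g: "\<And>v. 0 \<le> v \<Longrightarrow> 0 \<le> g v \<and> g v \<le> L * v" "\<And>v. v \<le> 0 \<Longrightarrow> L * v \<le> g v \<and> g v \<le> 0"
    and Y0: "Y 0 = X 0" and X0: "0 \<le> X 0"
    and X: "\<And>n. n \<le> r \<Longrightarrow> X (Suc n) = Y n - g (Y n) / L"
    and Y: "\<And>n. n < r \<Longrightarrow> \<exists>b\<ge>0. Y (Suc n) = X (Suc n) + b * (X (Suc n) - X n)"
    and nr: "\<And>n. n < r \<Longrightarrow> g (Y n) * (X (Suc n) - X n) \<le> 0"
    and re: "g (Y r) * (X (Suc r) - X r) > 0"
    and gX: "\<And>n. n \<le> r \<Longrightarrow> g (X n) \<noteq> 0"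
  shows "X (Suc r) \<le> 0 \<and> 0 \<le> X r"
proof -
  have pos: "0 \<le> X (Suc n) \<and> X (Suc n) \<le> Y n" if "n \<le> r" "0 \<le> Y n" for n
  proof -
    have "0 \<le> g (Y n) / L" "g (Y n) / L \<le> Y n"
      using g(1)[OF that(2)] L by (simp_all add: pos_divide_le_eq mult.commute)
    then show ?thesis using X[OF that(1)] by simp
  qed
  have neg: "X (Suc n) \<le> 0" if "n \<le> r" "Y n \<le> 0" for n
  proof -
    have "Y n \<le> g (Y n) / L"
      using g(2)[OF that(2)] L by (simp add: pos_le_divide_eq mult.commute)
    then show ?thesis using X[OF that(1)] by simp
  qed
  have g0: "g 0 = 0" using g(1)[of 0] by simp
  have inv: "0 \<le> X n \<and> Y n \<le> X n" if "n \<le> r" for n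
    using that
  proof (induction n)
    case 0
    then show ?case using Y0 X0 by simp
  next
    case (Suc n)
    then have IH: "0 \<le> X n" "Y n \<le> X n" by auto
    have "0 \<le> X (Suc n) \<and> X (Suc n) \<le> X n"
    proof (cases "0 \<le> Y n")
      case True
      with pos[of n] IH Suc.prems show ?thesis by auto
    next
      case False
      then have "X (Suc n) \<le> 0" using neg[of n] Suc.prems by simp
      moreover have "g (Y n) < 0"
      proof -
        \<comment> \<open>Otherwise the step would not move, and \<open>X (Suc n) = Y n\<close>
          would be a zero of \<open>g\<close>.\<close>
        have "g (Y n) \<noteq> 0" using X[of n] gX[of "Suc n"] Suc.prems by auto
        then show ?thesis using g(2)[of "Y n"] False by simp
      qed
      then have "X n \<le> X (Suc n)" using nr[of n] Suc.prems by (simp add: mult_le_0_iff)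
      ultimately have "X n = 0" using IH by simp
      then show ?thesis using gX[of n] g0 Suc.prems by simp
    qed
    moreover obtain b where "b \<ge> 0" "Y (Suc n) = X (Suc n) + b * (X (Suc n) - X n)"
      using Y[of n] Suc.prems by auto
    ultimately show ?case by (simp add: mult_nonneg_nonpos)
  qed
  have "\<not> 0 \<le> Y r"
  proof
    assume "0 \<le> Y r"
    then have "g (Y r) \<ge> 0" "X (Suc r) \<le> X r" using g(1) pos[of r] inv[of r] by auto
    then show False using re by (simp add: zero_less_mult_iff)
  qed
  then show ?thesis using neg[of r] inv[of r] by simp
qed

text \<open>Reduction to the normalized case by translating \<open>z\<close> to 0 and reflecting
  with the sign \<open>e\<close> of the starting side. The bounds on \<open>g\<close> come from the
  Lipschitz condition (size) and from convexity (sign). The product in the conclusion is invariant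
  under the reflection.\<close>

lemma overshoot:
  fixes X Y :: "nat \<Rightarrow> real"
  assumes f: "convex_on UNIV f" "L_smooth L f" "L > 0"
    and z: "\<And>w. f z \<le> f w"
    and Y0: "Y 0 = X 0"
    and X: "\<And>n. n \<le> r \<Longrightarrow> X (Suc n) = gradient_step f L (Y n)"
    and Y: "\<And>n. n < r \<Longrightarrow> \<exists>b\<ge>0. Y (Suc n) = X (Suc n) + b * (X (Suc n) - X n)"
    and nr: "\<And>n. n < r \<Longrightarrow> \<not> restart_at f X Y n"
    and re: "restart_at f X Y r"
    and fX: "\<And>n. n \<le> r \<Longrightarrow> deriv f (X n) \<noteq> 0"
  shows "(X (Suc r) - z) * (X r - z) \<le> 0"
proof -
  define e :: real where "e = (if 0 \<le> X 0 - z then 1 else -1)"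
  have e: "e * e = 1" "e * (e * w) = w" for w by (auto simp: e_def)
  define g where "g v = e * deriv f (z + e * v)" for v
  have gz: "g (e * (w - z)) = e * deriv f w" for w
    by (simp add: g_def e)
  have dz: "deriv f z = 0"
    using f(2) z by (rule deriv_minimizer_eq_0)
  have lip: "\<bar>g v\<bar> \<le> L * \<bar>v\<bar>" for v
  proof -
    have "\<bar>deriv f (z + e * v) - deriv f z\<bar> \<le> L * \<bar>z + e * v - z\<bar>"
      using f(2) unfolding L_smooth_def by blast
    then show ?thesis by (auto simp: g_def dz e_def abs_mult)
  qed
  have gv: "0 \<le> g v * v" for v
    using convex_above_tangent[OF f(1,2), of "z + e * v" z] z[of "z + e * v"]
    by (simp add: g_def mult_ac)
  have "e * (X (Suc r) - z) \<le> 0 \<and> 0 \<le> e * (X r - z)"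
  proof (rule overshoot_nonneg[where X = "\<lambda>n. e * (X n - z)" and Y = "\<lambda>n. e * (Y n - z)" and g = g])
    show "0 \<le> g v \<and> g v \<le> L * v" if "0 \<le> v" for v
      using gv[of v] lip[of v] that by (cases "v = 0") (auto simp: zero_le_mult_iff)
    show "L * v \<le> g v \<and> g v \<le> 0" if "v \<le> 0" for v
      using gv[of v] lip[of v] that by (cases "v = 0") (auto simp: zero_le_mult_iff)
    show "e * (X (Suc n) - z) = e * (Y n - z) - g (e * (Y n - z)) / L" if "n \<le> r" for n
      unfolding gz X[OF that] gradient_step_def by (simp add: algebra_simps)
    show "\<exists>b\<ge>0. e * (Y (Suc n) - z)
        = e * (X (Suc n) - z) + b * (e * (X (Suc n) - z) - e * (X n - z))" if "n < r" for n
    proof -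
      obtain b where b: "b \<ge> 0" "Y (Suc n) = X (Suc n) + b * (X (Suc n) - X n)"
        using Y \<open>n < r\<close> by blast
      show ?thesis
        unfolding b(2) by (intro exI[of _ b] conjI b(1)) (simp add: algebra_simps)
    qed
    have eq: "g (e * (Y n - z)) * (e * (X (Suc n) - z) - e * (X n - z))
        = deriv f (Y n) * (X (Suc n) - X n)" for n
      unfolding gz by (auto simp: e_def algebra_simps)
    show "g (e * (Y n - z)) * (e * (X (Suc n) - z) - e * (X n - z)) \<le> 0" if "n < r" for n
      using nr[OF that] unfolding eq by (simp add: restart_at_def)
    show "g (e * (Y r - z)) * (e * (X (Suc r) - z) - e * (X r - z)) > 0"
      using re unfolding eq by (simp add: restart_at_def)
    show "g (e * (X n - z)) \<noteq> 0" if "n \<le> r" for n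
      using fX[OF that] unfolding gz by (simp add: e_def)
  qed (use Y0 f(3) in \<open>auto simp: e_def\<close>)
  then have "(e * (X (Suc r) - z)) * (e * (X r - z)) \<le> 0"
    by (simp add: mult_nonpos_nonneg)
  then show ?thesis by (simp add: e mult_ac)
qed

text \<open>\<open>Argmin f\<close> is a sublevel set of a continuous function, hence closed, so the
  closest point belongs to it.\<close>

lemma closest_point_Argmin:
  assumes "continuous_on UNIV f" "Argmin f \<noteq> {}"
  shows "f (closest_point (Argmin f) x0) \<le> f w"
proof -
  obtain m where "\<And>w. f m \<le> f w"
    using assms(2) by (auto simp: Argmin_def is_arg_min_def not_less)
  then have "Argmin f = {x. f x \<le> f m}"
    by (auto simp: Argmin_def is_arg_min_def not_less intro: order_trans)
  then have "closed (Argmin f)"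
    using assms(1) by (simp add: closed_Collect_le)
  then have "closest_point (Argmin f) x0 \<in> Argmin f"
    using assms(2) by (rule closest_point_in_set)
  then show ?thesis by (auto simp: Argmin_def is_arg_min_def not_less)
qed

section \<open>Rates before and after the first restart\<close>

theorem theorem8:
  fixes f :: "real \<Rightarrow> real" and L x0 xstar fstar :: real
    and S :: "real set" and tt x y :: "nat \<Rightarrow> real" and r rbar :: nat
  assumes "convex_on UNIV f" and "L > 0" and "L_smooth L f"
    and "S = Argmin f" and "S \<noteq> {}"
    and "fstar = (LEAST v. v \<in> range f)"
    and "xstar = closest_point S x0"
    and "admissible_params tt"
    and "x = agd_x f L x0 tt" and "y = agd_y f L x0 tt"
    and "restart_at f x y r" and "\<forall>k<r. \<not> restart_at f x y k"
    and "r < rbar" and "restart_at f x y rbar"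
    and "\<forall>k. r < k \<and> k < rbar \<longrightarrow> \<not> restart_at f x y k"
    and "\<forall>j\<le>rbar. deriv f (x j) \<noteq> 0"
  shows "(\<forall>k\<le>r + 1. f (x k) - fstar \<le> 2 * L * (x0 - xstar)\<^sup>2 / (real k + 1)\<^sup>2)
    \<and> f (x (r + 2)) \<le> f (x (r + 1))
    \<and> (\<forall>k\<in>{r + 3..rbar + 1}.
         f (x k) - fstar
           \<le> (4 / ((real k - real r) * (real r + 2)))\<^sup>2 * (L * (x0 - xstar)\<^sup>2 / 2)
         \<and> (4 / ((real k - real r) * (real r + 2)))\<^sup>2 * (L * (x0 - xstar)\<^sup>2 / 2)
           \<le> 2 * L * (x0 - xstar)\<^sup>2 / (real k + 1)\<^sup>2)"
proof -
  note f = assms(1,3,2) and tt = assms(8)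
  have xdef: "x = agd_x f L x0 tt" and ydef: "y = agd_y f L x0 tt" by fact+
  have "continuous_on UNIV f"
    using L_smooth_DERIV[OF assms(3)] by (meson DERIV_isCont continuous_at_imp_continuous_on)
  then have min: "f xstar \<le> f w" for w
    using closest_point_Argmin assms(4,5,7) by simp
  have fstar: "fstar = f xstar"
    unfolding assms(6) by (rule Least_equality) (use min in auto)
  have x0: "x 0 = x0" "y 0 = x0"
    by (simp_all add: xdef ydef agd_x_def agd_y_def)
  have xS: "x (Suc k) = gradient_step f L (y k)" for k
    by (simp add: xdef ydef agd_x_Suc)
  have re: "restart_at f x y r" and nr: "\<And>k. k < r \<Longrightarrow> \<not> restart_at f x y k"
    and nr2: "\<And>k. r < k \<Longrightarrow> k < rbar \<Longrightarrow> \<not> restart_at f x y k"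
    using assms by auto
  have run1: "y (Suc n) = x (Suc n) + (tt n - 1) / tt (Suc n) * (x (Suc n) - x n)" if "n < r" for n
    using agd_y_run[of 0 f L x0 tt n] nr that by (simp add: xdef ydef)
  have run2: "y (Suc r + Suc n) = x (Suc r + Suc n)
      + (tt n - 1) / tt (Suc n) * (x (Suc r + Suc n) - x (Suc r + n))" if "Suc r + n < rbar" for n
    unfolding xdef ydef
    by (rule agd_y_run[OF agd_t_restart]) (use re nr2 that xdef ydef in auto)
  have yr: "y (Suc r) = x (Suc r)"
    using agd_y_restart re by (simp add: xdef ydef)
  define d where "d = x0 - xstar"

  \<comment> \<open>For (ii): after the restart \<open>y (Suc r) = x (Suc r)\<close>, so the next
    iterate is a plain gradient step from \<open>x (Suc r)\<close>.\<close>
  have dec: "f (gradient_step f L v) \<le> f v" for v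
  proof -
    have "0 \<le> (deriv f v)\<^sup>2 / (2 * L)" using f(3) by simp
    then show ?thesis using gradient_step_le[OF f, of v v] by simp
  qed
  have rate1: "f (x (Suc n)) - fstar \<le> 2 * L * d\<^sup>2 / (real n + 2)\<^sup>2" if "n \<le> r" for n
    using accelerated_rate[OF f tt min, of y x r n] x0 xS run1 that by (simp add: fstar d_def)
  have part1: "f (x k) - fstar \<le> 2 * L * d\<^sup>2 / (real k + 1)\<^sup>2" if "k \<le> r + 1" for k
  proof (cases k)
    case 0
    \<comment> \<open>The index 0 precedes every gradient step, so the quadratic upper model at
      \<open>xstar\<close> gives the bound instead.\<close>
    have "deriv f xstar = 0"
      using f(2) min by (rule deriv_minimizer_eq_0)
    then have "f x0 - f xstar \<le> L / 2 * d\<^sup>2"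
      using L_smooth_descent[OF f(2), of xstar d] by (simp add: d_def)
    also have "\<dots> \<le> 2 * L * d\<^sup>2" using f(3) by simp
    finally show ?thesis using 0 x0 by (simp add: fstar)
  next
    case (Suc n)
    then show ?thesis using rate1[of n] that by (simp add: add_ac)
  qed

  \<comment> \<open>A gradient step from \<open>y k = x k\<close> never satisfies the restart
    condition. This covers iteration 0 and, since \<open>tt 0 = 1\<close> removes the first momentum
    term, iteration 1.\<close>
  have "2 \<le> r"
  proof -
    have no: "\<not> restart_at f x y k" if "y k = x k" for k
    proof -
      have "deriv f (y k) * (x (k + 1) - x k) = - ((deriv f (y k))\<^sup>2 / L)"
        using xS[of k] that by (simp add: gradient_step_def power2_eq_square)
      moreover have "0 \<le> (deriv f (y k))\<^sup>2 / L" using f(3) by simp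
      ultimately show ?thesis by (simp add: restart_at_def)
    qed
    have "r \<noteq> 0" using no[of r] re x0 by metis
    then have "y 1 = x 1"
      using run1[of 0] tt by (simp add: admissible_params_def)
    then have "r \<noteq> 1" using no[of r] re by metis
    with \<open>r \<noteq> 0\<close> show ?thesis by simp
  qed

  have "(x (Suc r) - xstar) * (x r - xstar) \<le> 0"
  proof (rule overshoot[OF f min _ _ _ nr re])
    show "\<exists>b\<ge>0. y (Suc n) = x (Suc n) + b * (x (Suc n) - x n)" if "n < r" for n
      using run1[OF that] admissible_params_ge_1[OF tt, of n] admissible_params_ge_1[OF tt, of "Suc n"]
      by (intro exI[of _ "(tt n - 1) / tt (Suc n)"]) auto
  qed (use x0 xS assms(13,16) in auto)
  \<comment> \<open>This is the product in the cross term of the expanded square of u at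
    \<open>r\<close>. Its sign lets the cross term and the second square be discarded.\<close>
  then have opp: "tt r * (x (Suc r) - xstar) * ((tt r - 1) * (x r - xstar)) \<le> 0"
    using admissible_params_ge_1[OF tt, of r]
      mult_nonneg_nonpos[of "tt r * (tt r - 1)" "(x (Suc r) - xstar) * (x r - xstar)"]
    by (simp add: mult_ac)
  have "(tt r * (x (Suc r) - xstar) - (tt r - 1) * (x r - xstar))\<^sup>2 \<le> d\<^sup>2"
  proof -
    have "0 \<le> 2 / L * (tt r)\<^sup>2 * (f (x (Suc r)) - f xstar)"
      using min f(3) by simp
    then show ?thesis
      using accelerated_lyapunov[OF f tt min, of y x r r] x0 xS run1 by (simp add: d_def)
  qed
  then have "(tt r * (x (Suc r) - xstar))\<^sup>2 \<le> d\<^sup>2"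
    using opp zero_le_power2[of "(tt r - 1) * (x r - xstar)"]
    unfolding power2_diff by linarith
  moreover have "((real r + 2) / 2)\<^sup>2 \<le> (tt r)\<^sup>2"
    by (rule power_mono[OF admissible_params_ge[OF tt]]) simp
  then have "((real r + 2) / 2)\<^sup>2 * (x (Suc r) - xstar)\<^sup>2 \<le> (tt r)\<^sup>2 * (x (Suc r) - xstar)\<^sup>2"
    by (rule mult_right_mono) simp
  ultimately have "(x (Suc r) - xstar)\<^sup>2 * ((real r + 2) / 2)\<^sup>2 \<le> d\<^sup>2"
    by (simp only: power_mult_distrib mult.commute)
  moreover have "0 < ((real r + 2) / 2)\<^sup>2" by simp
  ultimately have "(x (Suc r) - xstar)\<^sup>2 \<le> d\<^sup>2 / ((real r + 2) / 2)\<^sup>2"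
    by (simp only: pos_le_divide_eq)
  then have closer: "(x (Suc r) - xstar)\<^sup>2 \<le> 4 * d\<^sup>2 / (real r + 2)\<^sup>2"
    by (simp add: power_divide mult.commute)

  have part3: "f (x k) - fstar \<le> (4 / ((real k - real r) * (real r + 2)))\<^sup>2 * (L * d\<^sup>2 / 2)"
    if k: "r + 3 \<le> k" "k \<le> rbar + 1" for k
  proof -
    \<comment> \<open>The position within the second run, chosen so that
      \<open>real n + 2 = real k - real r\<close>. The case \<open>k = rbar + 1\<close> is included,
      because \<open>x (rbar + 1)\<close> is computed before the second restart takes
      effect.\<close>
    define n where "n = k - (r + 2)"
    have kn: "k = Suc r + Suc n" using k by (simp add: n_def)
    have "f (x (Suc r + Suc n)) - f xstar \<le> 2 * L * (x (Suc r + 0) - xstar)\<^sup>2 / (real n + 2)\<^sup>2"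
      by (rule accelerated_rate[OF f tt min, where X = "\<lambda>i. x (Suc r + i)"
            and Y = "\<lambda>i. y (Suc r + i)" and N = n])
        (use yr xS run2 k kn in auto)
    also have "\<dots> \<le> 2 * L * (4 * d\<^sup>2 / (real r + 2)\<^sup>2) / (real n + 2)\<^sup>2"
      using closer f(3) by (intro divide_right_mono mult_left_mono) auto
    also have "\<dots> = (4 / ((real k - real r) * (real r + 2)))\<^sup>2 * (L * d\<^sup>2 / 2)"
      by (simp add: kn power_divide power_mult_distrib add_ac)
    finally show ?thesis by (simp add: kn fstar)
  qed

  have part4: "(4 / ((real k - real r) * (real r + 2)))\<^sup>2 * (L * d\<^sup>2 / 2)
      \<le> 2 * L * d\<^sup>2 / (real k + 1)\<^sup>2" if k: "r + 3 \<le> k" for k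
  proof -
    \<comment> \<open>This expression equals (k - r)(r + 2) - 2(k + 1), the difference of the
      cross-multiplied denominators. At \<open>k = r + 3\<close> it reduces to r - 2, which is where
      \<open>2 \<le> r\<close> enters.\<close>
    have "0 \<le> (real k - real r - 3) * real r + (real r - 2)"
      using k \<open>2 \<le> r\<close> by (intro add_nonneg_nonneg mult_nonneg_nonneg) auto
    then have "4 / ((real k - real r) * (real r + 2)) \<le> 2 / (real k + 1)"
      using k by (simp add: divide_simps) (simp add: algebra_simps)
    then have "(4 / ((real k - real r) * (real r + 2)))\<^sup>2 * (L * d\<^sup>2 / 2)
        \<le> (2 / (real k + 1))\<^sup>2 * (L * d\<^sup>2 / 2)"
      using k f(3) by (intro mult_right_mono power_mono) auto
    then show ?thesis by (simp add: power_divide)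
  qed

  show ?thesis
    using part1 part3 part4 dec[of "x (Suc r)"] xS[of "Suc r"] yr
    by (auto simp: d_def)
qed

end
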